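(* Let $n,d\geq 1$, let $P(\lambda)=A_0+A_1\lambda+\dots+A_d\lambda^d$ be a matrix polynomial of degree $d$ with $A_j\in\mathbb{C}^{n\times n}$, and let $\zeta_1,\dots,\zeta_{nd}$ be its eigenvalues, arranged by non-decreasing modulus. Let $\|\cdot\|$ be any norm on $\mathbb{C}^{n\times n}$ satisfying (A1), assume $\det A_0\neq 0$, and let $c=\frac{|\det A_0|}{\|A_0\|^n}$. Let $\alpha_1\leq\dots\leq\alpha_d$ be the tropical roots of $\mathsf{t}p(x)=\max_{0\leq j\leq d}\|A_j\|x^j$, and for $K\in\{1,\dots,nd\}$ let $\bar\alpha_K=\alpha_{\lceil K/n\rceil}$. Then, for all $K\in\{1,\dots,nd\}$, $$\frac{|\zeta_1\cdots\zeta_K|}{\bar\alpha_1\cdots\bar\alpha_K}\geq c\,(L_{K/n})^n ,$$ where, for real $0<k\leq d$, $$L_k=\frac{1}{\mathcal{E}(k)(k+1)},\qquad \mathcal{E}(k)=\Big(\frac{k+1}{k}\Big)^k .$$ Moreover, when $\|\cdot\|$ satisfies (A2), the inequality holds with the greater constant $$L_k=\frac{1}{\sqrt{\mathcal{E}(k)(k+1)}} .$$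
   Context: (A1): $|\det A|\leq\|A\|^n$ for all $A\in\mathbb{C}^{n\times n}$. (A2): there exist $Q,Q'\in\mathbb{C}^{n\times n}$ with $\det Q=\det Q'=1$ and $\|QAQ'\|_{\mathrm{nF}}\leq\|A\|$ for all $A\in\mathbb{C}^{n\times n}$, where $\|A\|_{\mathrm{nF}}=\big(\frac1n\sum_{i,j=1}^n|A_{ij}|^2\big)^{1/2}$ is the normalized Frobenius norm. Degree $d$ means $A_d\neq0$. The eigenvalues of $P$ are the roots of the polynomial $\det P(\lambda)$ counted with multiplicities; if $\det P$ has degree less than $nd$, the list is completed to $nd$ entries by infinite eigenvalues, whose modulus is $+\infty$. The tropical roots of $\mathsf{t}p$ are the unique numbers $0\leq\alpha_1\leq\dots\leq\alpha_d$ such that $\mathsf{t}p(x)=\|A_d\|\prod_{j=1}^d\max(x,\alpha_j)$ for all $x\geq0$. They are all positive when $A_0\neq0$. $\lceil x\rceil$ is the least integer $\geq x$. *)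

theory Defs
  imports "HOL-Analysis.Analysis" "HOL-Computational_Algebra.Computational_Algebra"
begin

text \<open>
  Homogeneity is with respect to complex scalars. The entrywise scalar multiple is written out,
  since the scaling operations of \<open>complex ^ 'n ^ 'n\<close> only accept real scalars or row vectors.
\<close>

definition matrix_norm :: "(complex ^ 'n ^ 'n \<Rightarrow> real) \<Rightarrow> bool" where
  "matrix_norm N \<longleftrightarrow>
     (\<forall>A. N A \<ge> 0) \<and>
     (\<forall>A. N A = 0 \<longleftrightarrow> A = 0) \<and>
     (\<forall>c A. N (\<chi> i j. c * A $ i $ j) = cmod c * N A) \<and>
     (\<forall>A B. N (A + B) \<le> N A + N B)"

definition normalized_frobenius :: "complex ^ 'n ^ 'n \<Rightarrow> real" where
  "normalized_frobenius A =
     sqrt (1 / real CARD('n) * (\<Sum>i\<in>UNIV. \<Sum>j\<in>UNIV. (cmod (A $ i $ j))\<^sup>2))"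

definition assumption_A1 :: "(complex ^ 'n ^ 'n \<Rightarrow> real) \<Rightarrow> bool" where
  "assumption_A1 N \<longleftrightarrow> (\<forall>A. cmod (det A) \<le> N A ^ CARD('n))"

definition assumption_A2 :: "(complex ^ 'n ^ 'n \<Rightarrow> real) \<Rightarrow> bool" where
  "assumption_A2 N \<longleftrightarrow>
     (\<exists>Q Q'. det Q = 1 \<and> det Q' = 1 \<and>
        (\<forall>A. normalized_frobenius (Q ** A ** Q') \<le> N A))"

text \<open>
  The matrix polynomial \<open>A\<^sub>0 + A\<^sub>1 \<lambda> + \<dots> + A\<^sub>d \<lambda>\<^sup>d\<close> as a matrix with polynomial entries.
  Only \<open>A 0, \<dots>, A d\<close> matter.
\<close>

definition matrix_polynomial ::
    "(nat \<Rightarrow> complex ^ 'n ^ 'n) \<Rightarrow> nat \<Rightarrow> complex poly ^ 'n ^ 'n" where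
  "matrix_polynomial A d = (\<chi> i j. \<Sum>k\<le>d. monom (A k $ i $ j) k)"

text \<open>
  Eigenvalues live in the extended complex plane: \<open>Some z\<close> is the finite value \<open>z\<close> and
  \<open>None\<close> is infinity. The multiset below is meaningful when the determinant is not the zero
  polynomial; its degree is then at most \<open>CARD('n) * d\<close>, so the subtraction does not truncate
  and the multiset has exactly \<open>CARD('n) * d\<close> elements.
\<close>

definition eigenvalues ::
    "(nat \<Rightarrow> complex ^ 'n ^ 'n) \<Rightarrow> nat \<Rightarrow> complex option multiset" where
  "eigenvalues A d =
     (let p = det (matrix_polynomial A d)
      in image_mset Some (proots p) + replicate_mset (CARD('n) * d - degree p) None)"

text \<open>
  In \<^typ>\<open>ereal\<close>, \<open>0 * \<infinity> = 0\<close>, so a product of moduli is the modulus of the product of the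
  eigenvalues only when \<open>0\<close> and infinity do not both occur, e.g. when \<open>A 0\<close> is invertible.
\<close>

fun modulus :: "complex option \<Rightarrow> ereal" where
  "modulus (Some z) = ereal (cmod z)"
| "modulus None = \<infinity>"

definition sorted_eigenvalues ::
    "(nat \<Rightarrow> complex ^ 'n ^ 'n) \<Rightarrow> nat \<Rightarrow> (nat \<Rightarrow> complex option) \<Rightarrow> bool" where
  "sorted_eigenvalues A d \<zeta> \<longleftrightarrow>
     image_mset \<zeta> (mset_set {1..CARD('n) * d}) = eigenvalues A d \<and>
     mono_on {1..CARD('n) * d} (\<lambda>i. modulus (\<zeta> i))"

definition tropical_polynomial ::
    "(complex ^ 'n ^ 'n \<Rightarrow> real) \<Rightarrow> (nat \<Rightarrow> complex ^ 'n ^ 'n) \<Rightarrow> nat \<Rightarrow> real \<Rightarrow> real" where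
  "tropical_polynomial N A d x = (MAX j\<in>{..d}. N (A j) * x ^ j)"

definition tropical_roots ::
    "(complex ^ 'n ^ 'n \<Rightarrow> real) \<Rightarrow> (nat \<Rightarrow> complex ^ 'n ^ 'n) \<Rightarrow> nat \<Rightarrow> (nat \<Rightarrow> real) \<Rightarrow> bool" where
  "tropical_roots N A d \<alpha> \<longleftrightarrow>
     (\<forall>j\<in>{1..d}. 0 \<le> \<alpha> j) \<and>
     mono_on {1..d} \<alpha> \<and>
     (\<forall>x\<ge>0. tropical_polynomial N A d x = N (A d) * (\<Prod>j=1..d. max x (\<alpha> j)))"

definition \<E> :: "real \<Rightarrow> real" where
  "\<E> k = ((k + 1) / k) powr k"

definition L :: "real \<Rightarrow> real" where
  "L k = 1 / (\<E> k * (k + 1))"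

definition L_A2 :: "real \<Rightarrow> real" where
  "L_A2 k = 1 / sqrt (\<E> k * (k + 1))"

lemma L_less_L_A2:
  assumes "k > 0"
  shows "L k < L_A2 k"
proof -
  have "\<E> k \<ge> 1"
    unfolding \<E>_def using assms by (intro ge_one_powr_ge_zero) auto
  then have "1 * 1 < \<E> k * (k + 1)"
    using assms by (intro mult_le_less_imp_less) auto
  then have *: "1 < \<E> k * (k + 1)" by simp
  define u where "u = sqrt (\<E> k * (k + 1))"
  have u: "u * u = \<E> k * (k + 1)" "u > 1"
    unfolding u_def using * by auto
  have "u * 1 < u * u"
    using u(2) by (intro mult_strict_left_mono) auto
  then have "sqrt (\<E> k * (k + 1)) < \<E> k * (k + 1)"
    using u by (simp add: u_def)
  then show ?thesis
    unfolding L_def L_A2_def using * by (intro divide_strict_left_mono) auto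
qed

end

theory Submission
  imports Defs
begin

text \<open>
  Put \<open>p = det P\<close> and \<open>n = CARD('n)\<close>. For \<open>r > 0\<close>, Jensen's formula bounds
  \<open>\<bar>p(0)\<bar> r\<^sup>K / \<bar>\<zeta>\<^sub>1 \<cdots> \<zeta>\<^sub>K\<bar>\<close> by the geometric mean of \<open>\<bar>p\<bar>\<close> over the circle of radius \<open>r\<close>,
  for any choice of \<open>K\<close> finite eigenvalues. No integral is needed: the geometric mean over the points
  \<open>r w\<close> with \<open>w ^ M = 1\<close> is explicit in terms of the roots, because
  \<open>\<Prod>w. (r w - z)\<close> is \<open>r ^ M - z ^ M\<close> up to sign, and the limit of this mean as \<open>M\<close> grows
  gives the bound (\<open>geometric_mean_bound_imp_root_bound\<close>).

  The geometric mean is then bounded through the norm. Under \<open>assumption_A1\<close> it is at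
  most the maximum, hence at most \<open>(\<Sum>j. \<parallel>A\<^sub>j\<parallel> r\<^sup>j)\<^sup>n\<close>. Under \<open>assumption_A2\<close>
  Hadamard's inequality (\<open>hadamard_inequality\<close>) and the
  inequality of arithmetic and geometric means give
  \<open>\<bar>det X\<bar>\<^sup>2 \<le> (\<parallel>X\<parallel>\<^sub>n\<^sub>F\<^sup>2)\<^sup>n\<close>; the geometric mean of the squared Frobenius norm of
  \<open>Q P Q'\<close> is at most its arithmetic mean, and Parseval's identity
  (\<open>parseval_roots_unity\<close>) removes all cross terms,
  leaving \<open>(\<Sum>j. \<parallel>A\<^sub>j\<parallel>\<^sup>2 r\<^sup>2\<^sup>j) powr (n / 2)\<close>. The gain of a square root in the constant
  comes from here.

  It remains to choose \<open>r\<close>. Write \<open>\<beta>\<close> for the \<open>K\<close>-th entry of the list in which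
  every tropical root is repeated \<open>n\<close> times. Since \<open>\<parallel>A\<^sub>j\<parallel> \<alpha>\<^sub>1 \<cdots> \<alpha>\<^sub>j \<le> \<parallel>A\<^sub>0\<parallel>\<close> and the list is
  non-decreasing, \<open>\<parallel>A\<^sub>j\<parallel> \<beta>\<^sup>j\<close> is bounded, uniformly in \<open>j\<close>, by \<open>\<parallel>A\<^sub>0\<parallel>\<close> times the \<open>n\<close>-th root of
  \<open>\<beta>\<^sup>K\<close> divided by the product of the first \<open>K\<close> entries
  (\<open>prod_initial_segment_times_power_le\<close>). With \<open>r = \<beta> t\<close> the sums above are therefore
  dominated by geometric series in \<open>\<tau> = t\<close> or \<open>\<tau> = t\<^sup>2\<close>, of sum \<open>1 / (1 - \<tau>)\<close>, and
  \<open>\<tau> powr k * (1 - \<tau>)\<close> with \<open>k = K / n\<close> is largest at \<open>\<tau> = k / (k + 1)\<close>, where its value is \<open>L k\<close>.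
  In the second case a square root is taken, which gives \<open>L_A2 k\<close>.
\<close>

unbundle no Formal_Power_Series.fps_syntax \<comment> \<open>leaves \<open>$\<close> to vectors\<close>

section \<open>Jensen's inequality for polynomials from roots of unity\<close>

lemma prod_diff_roots_unity:
  fixes x :: complex
  assumes "M > 0"
  shows "(\<Prod>w | w ^ M = 1. x - w) = x ^ M - 1"
proof -
  define p :: "complex poly" where "p = monom 1 M - 1"
  have roots: "poly p w = 0 \<longleftrightarrow> w ^ M = 1" for w
    by (simp add: p_def poly_monom)
  have deg: "degree p = M"
  proof (rule antisym)
    show "degree p \<le> M" unfolding p_def by (intro degree_diff_le) (auto simp: degree_monom_le)
    show "M \<le> degree p" using assms by (intro le_degree) (auto simp: p_def)
  qed
  then have lead: "lead_coeff p = 1" using assms by (simp add: p_def)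
  have "rsquarefree p"
    using assms by (auto simp: rsquarefree_roots p_def pderiv_diff pderiv_monom poly_monom zero_power)
  from complex_poly_decompose_rsquarefree[OF this] 
  have "p = (\<Prod>w | w ^ M = 1. [:-w, 1:])" by (simp add: roots lead)
  then have "poly p x = (\<Prod>w | w ^ M = 1. x - w)" by (simp add: poly_prod)
  then show ?thesis by (simp add: p_def poly_monom)
qed

lemma prod_norm_diff_roots_unity:
  fixes \<zeta> :: complex
  assumes "M > 0" "r > 0" "\<zeta> \<noteq> 0"
  shows "(\<Prod>w | w ^ M = 1. cmod (of_real r * w - \<zeta>)) = cmod \<zeta> ^ M * cmod (1 - (of_real r / \<zeta>) ^ M)"
proof -
  have "(\<Prod>w | w ^ M = 1. cmod (of_real r * w - \<zeta>)) = (\<Prod>w::complex | w ^ M = 1. r * cmod (\<zeta> / r - w))"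
  proof (intro prod.cong refl)
    fix w :: complex
    have "of_real r * w - \<zeta> = - (of_real r * (\<zeta> / of_real r - w))" using assms by (simp add: field_simps)
    then show "cmod (of_real r * w - \<zeta>) = r * cmod (\<zeta> / r - w)"
      using assms by (simp add: norm_mult)
  qed
  also have "\<dots> = r ^ M * cmod (\<Prod>w | w ^ M = 1. \<zeta> / r - w)"
    using assms by (simp add: prod.distrib card_roots_unity_eq prod_norm)
  also have "\<dots> = cmod (of_real r ^ M * ((\<zeta> / r) ^ M - 1))"
    using assms by (simp add: prod_diff_roots_unity norm_mult norm_power)
  also have "of_real r ^ M * ((\<zeta> / r) ^ M - 1) = \<zeta> ^ M * (1 - (of_real r / \<zeta>) ^ M)"
    using assms by (simp add: field_simps power_divide)
  finally show ?thesis by (simp add: norm_mult norm_power)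
qed

text \<open>
  In absolute value, the larger of the two terms \<open>1\<close> and \<open>w ^ M\<close> dominates exponentially. The
  hypothesis cannot be dropped: for \<open>w\<close> a root of unity the sequence vanishes infinitely often.
\<close>

lemma root_norm_one_minus_power_tendsto:
  fixes w :: complex
  assumes "cmod w \<noteq> 1"
  shows "(\<lambda>M. root M (cmod (1 - w ^ M))) \<longlonglongrightarrow> max 1 (cmod w)"
proof -
  have small: "(\<lambda>M. root M (cmod (1 - v ^ M))) \<longlonglongrightarrow> 1" if v: "cmod v < 1" for v :: complex
  proof -
    have "(\<lambda>M. v ^ M) \<longlonglongrightarrow> 0" using v by (rule LIMSEQ_power_zero)
    then have "(\<lambda>M. cmod (1 - v ^ M)) \<longlonglongrightarrow> cmod (1 - 0)" by (intro tendsto_norm tendsto_diff tendsto_const)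
    then have lim: "(\<lambda>M. cmod (1 - v ^ M) powr (1 / real M)) \<longlonglongrightarrow> cmod (1 - 0) powr 0"
      by (rule tendsto_powr) (auto intro: lim_1_over_n)
    have "\<forall>\<^sub>F M in sequentially. cmod (1 - v ^ M) powr (1 / real M) = root M (cmod (1 - v ^ M))"
      using eventually_gt_at_top[of 0]
    proof eventually_elim
      case (elim M)
      have "cmod (v ^ M) < 1" using v elim by (simp add: norm_power power_less_one_iff)
      then have "1 - v ^ M \<noteq> 0" by auto
      then show ?case using elim by (subst root_powr_inverse) (auto simp: divide_simps)
    qed
    with lim show ?thesis by (simp add: tendsto_cong)
  qed
  show ?thesis
  proof (cases "cmod w < 1")
    case True
    then show ?thesis using small[of w] by (simp add: max_def)
  next
    case False
    with assms have w: "cmod w > 1" by simp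
    have "(\<lambda>M. cmod w * root M (cmod (1 - (1 / w) ^ M))) \<longlonglongrightarrow> cmod w * 1"
      using w by (intro tendsto_mult small tendsto_const) (simp add: norm_divide divide_less_eq)
    moreover have "\<forall>\<^sub>F M in sequentially.
        cmod w * root M (cmod (1 - (1 / w) ^ M)) = root M (cmod (1 - w ^ M))"
      using eventually_gt_at_top[of 0]
    proof eventually_elim
      case (elim M)
      have "1 - w ^ M = - (w ^ M * (1 - (1 / w) ^ M))" using w
        by (auto simp: field_simps power_divide)
      then have "cmod (1 - w ^ M) = cmod w ^ M * cmod (1 - (1 / w) ^ M)"
        by (simp add: norm_mult norm_power norm_minus_commute)
      then show ?case using elim by (simp add: real_root_mult real_root_power_cancel)
    qed
    ultimately show ?thesis using w by (simp add: tendsto_cong max_def)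
  qed
qed

lemma tendsto_prod_mset:
  fixes f :: "'a \<Rightarrow> 'b \<Rightarrow> real"
  assumes "\<And>x. x \<in># R \<Longrightarrow> (f x \<longlongrightarrow> g x) F"
  shows "((\<lambda>y. \<Prod>x\<in>#R. f x y) \<longlongrightarrow> (\<Prod>x\<in>#R. g x)) F"
  using assms by (induction R) (auto intro!: tendsto_mult)

lemma norm_poly_conv_prod_mset:
  fixes p :: "complex poly"
  shows "cmod (poly p x) = cmod (lead_coeff p) * (\<Prod>z\<in>#proots p. cmod (x - z))"
proof -
  have "poly p x = lead_coeff p * (\<Prod>z\<in>#proots p. x - z)"
  proof -
    have "poly (\<Prod>z\<in>#R. [:-z, 1:]) x = (\<Prod>z\<in>#R. x - z)" for R :: "complex multiset"
      by (induction R) (auto simp: algebra_simps)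
    then show ?thesis
      using arg_cong[OF complex_poly_decompose_multiset[of p], of "\<lambda>q. poly q x"] by simp
  qed
  moreover have "cmod (\<Prod>z\<in>#R. x - z) = (\<Prod>z\<in>#R. cmod (x - z))" for R :: "complex multiset"
    by (induction R) (auto simp: norm_mult)
  ultimately show ?thesis by (simp add: norm_mult)
qed

text \<open>
  The geometric mean of \<open>\<bar>p\<bar>\<close> over the points \<open>r w\<close> with \<open>w ^ M = 1\<close> equals \<open>\<bar>p(0)\<bar>\<close> times the product of
  \<open>\<bar>1 - (r / z) ^ M\<bar> powr (1 / M)\<close> over the roots \<open>z\<close> of \<open>p\<close>. As \<open>M\<close> grows, the factor of \<open>z\<close> tends to
  \<open>max 1 (r / \<bar>z\<bar>)\<close>, which is at least \<open>1\<close> and at least \<open>r / \<bar>z\<bar>\<close>: use the second bound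
  for the roots in \<open>R\<close> and the first one for the others.
\<close>

lemma geometric_mean_bound_imp_root_bound_off_circle:
  fixes p :: "complex poly"
  assumes p0: "poly p 0 \<noteq> 0" and r: "r > 0"
    and off: "\<And>z. poly p z = 0 \<Longrightarrow> cmod z \<noteq> r"
    and R: "R \<subseteq># proots p" and B: "B \<ge> 0"
    and mean: "\<And>M. M > d \<Longrightarrow> (\<Prod>w | w ^ M = 1. cmod (poly p (of_real r * w))) \<le> B ^ M"
  shows "cmod (poly p 0) * r ^ size R \<le> B * (\<Prod>z\<in>#R. cmod z)"
proof -
  have pnz: "p \<noteq> 0" using p0 by auto
  have nz: "z \<noteq> 0" if "z \<in># proots p" for z using that p0 pnz by auto
  have means: "root M (\<Prod>w | w ^ M = 1. cmod (poly p (of_real r * w))) =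
      cmod (poly p 0) * (\<Prod>z\<in>#proots p. root M (cmod (1 - (of_real r / z) ^ M)))" (is "_ = ?rhs M")
    if M: "M > 0" for M
  proof -
    have "(\<Prod>w | w ^ M = 1. cmod (poly p (of_real r * w))) =
       cmod (lead_coeff p) ^ M * (\<Prod>w | w ^ M = 1. \<Prod>z\<in>#proots p. cmod (of_real r * w - z))"
      by (subst norm_poly_conv_prod_mset) (simp add: prod.distrib card_roots_unity_eq M)
    also have "(\<Prod>w | w ^ M = 1. \<Prod>z\<in>#proots p. cmod (of_real r * w - z)) =
       (\<Prod>z\<in>#proots p. cmod z ^ M * cmod (1 - (of_real r / z) ^ M))"
    proof -
      have "(\<Prod>w | w ^ M = 1. \<Prod>z\<in>#S. cmod (of_real r * w - z)) =
         (\<Prod>z\<in>#S. cmod z ^ M * cmod (1 - (of_real r / z) ^ M))" if "\<And>z. z \<in># S \<Longrightarrow> z \<noteq> 0" for S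
        using that by (induction S) (auto simp: prod.distrib prod_norm_diff_roots_unity[OF M r])
      then show ?thesis using nz by blast
    qed
    also have "\<dots> = (\<Prod>z\<in>#proots p. cmod z) ^ M * (\<Prod>z\<in>#proots p. root M (cmod (1 - (of_real r / z) ^ M))) ^ M"
    proof -
      have "(\<Prod>z\<in>#S. cmod z ^ M * cmod (1 - (of_real r / z) ^ M)) =
         (\<Prod>z\<in>#S. cmod z) ^ M * (\<Prod>z\<in>#S. root M (cmod (1 - (of_real r / z) ^ M))) ^ M" for S
        using M by (induction S) (auto simp: power_mult_distrib)
      then show ?thesis by blast
    qed
    also have "cmod (lead_coeff p) ^ M * \<dots> = (?rhs M) ^ M"
      using norm_poly_conv_prod_mset[of p 0] by (simp add: power_mult_distrib)
    finally have "(\<Prod>w | w ^ M = 1. cmod (poly p (of_real r * w))) = (?rhs M) ^ M" .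
    moreover have "(\<Prod>z\<in>#S. root M (cmod (1 - (of_real r / z) ^ M))) \<ge> 0" for S
      using M by (induction S) (auto intro!: mult_nonneg_nonneg real_root_ge_zero)
    ultimately show ?thesis using M by (simp add: real_root_power_cancel)
  qed
  have "(\<lambda>M. ?rhs M) \<longlonglongrightarrow> cmod (poly p 0) * (\<Prod>z\<in>#proots p. max 1 (cmod (of_real r / z)))"
    using nz off pnz r
    by (intro tendsto_mult tendsto_const tendsto_prod_mset root_norm_one_minus_power_tendsto)
       (auto simp: norm_divide divide_simps)
  moreover have "\<forall>\<^sub>F M in sequentially. ?rhs M \<le> B"
    using eventually_gt_at_top[of d]
  proof eventually_elim
    case (elim M)
    then have "?rhs M \<le> root M (B ^ M)" using mean[OF elim] by (simp flip: means)
    then show ?case using elim B by (simp add: real_root_power_cancel)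
  qed
  ultimately have lim: "cmod (poly p 0) * (\<Prod>z\<in>#proots p. max 1 (cmod (of_real r / z))) \<le> B"
    by (rule tendsto_upperbound) simp
  obtain R' where R': "proots p = R + R'" using R by (metis subset_mset.add_diff_inverse)
  have "r ^ size S \<le> (\<Prod>z\<in>#S. max 1 (cmod (of_real r / z))) * (\<Prod>z\<in>#S. cmod z)"
    if "\<And>z. z \<in># S \<Longrightarrow> z \<noteq> 0" for S :: "complex multiset"
    using that
  proof (induction S)
    case (add z S)
    have "r \<le> max 1 (cmod (of_real r / z)) * cmod z"
      using add.prems r by (auto simp: norm_divide max_def field_simps)
    then have "r * r ^ size S \<le> (max 1 (cmod (of_real r / z)) * cmod z) *
       ((\<Prod>z\<in>#S. max 1 (cmod (of_real r / z))) * (\<Prod>z\<in>#S. cmod z))"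
      using add r by (intro mult_mono) auto
    then show ?case by (simp add: mult_ac)
  qed auto
  then have 1: "r ^ size R \<le> (\<Prod>z\<in>#R. max 1 (cmod (of_real r / z))) * (\<Prod>z\<in>#R. cmod z)"
    using nz R' by auto
  have 2: "(\<Prod>z\<in>#S. max 1 (cmod (of_real r / z))) \<ge> 1" for S
  proof (induction S)
    case (add z S)
    then have "1 * 1 \<le> max 1 (cmod (of_real r / z)) * (\<Prod>z\<in>#S. max 1 (cmod (of_real r / z)))"
      by (intro mult_mono) auto
    then show ?case by simp
  qed auto
  have 3: "(\<Prod>z\<in>#R. cmod z) \<ge> 0" by (induction R) auto
  have "cmod (poly p 0) * r ^ size R \<le> cmod (poly p 0) *
      ((\<Prod>z\<in>#R. max 1 (cmod (of_real r / z))) * (\<Prod>z\<in>#R. cmod z))"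
    using 1 by (intro mult_left_mono) auto
  also have "\<dots> \<le> cmod (poly p 0) *
      ((\<Prod>z\<in>#proots p. max 1 (cmod (of_real r / z))) * (\<Prod>z\<in>#R. cmod z))"
  proof -
    have "(\<Prod>z\<in>#R. max 1 (cmod (of_real r / z))) * 1 \<le> (\<Prod>z\<in>#proots p. max 1 (cmod (of_real r / z)))"
      unfolding R' using 2[of R] 2[of R'] by (simp only: image_mset_union prod_mset_Un) (intro mult_left_mono, auto)
    then show ?thesis using 3 by (intro mult_left_mono mult_right_mono) auto
  qed
  also have "\<dots> \<le> B * (\<Prod>z\<in>#R. cmod z)"
    using mult_right_mono[OF lim 3] by (simp add: mult_ac)
  finally show ?thesis .
qed

text \<open>
  Only finitely many radii carry a root, so continuity in the radius extends the bound to all of them.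
\<close>

lemma geometric_mean_bound_imp_root_bound:
  fixes p :: "complex poly"
  assumes p0: "poly p 0 \<noteq> 0" and r: "r > 0"
    and R: "R \<subseteq># proots p" 
    and B: "isCont B r" "\<And>x. x > 0 \<Longrightarrow> B x \<ge> 0"
    and mean: "\<And>x M. x > 0 \<Longrightarrow> M > d \<Longrightarrow> (\<Prod>w | w ^ M = 1. cmod (poly p (of_real x * w))) \<le> B x ^ M"
  shows "cmod (poly p 0) * r ^ size R \<le> B r * (\<Prod>z\<in>#R. cmod z)"
proof -
  have "finite (cmod ` {z. poly p z = 0})" using p0 by (intro finite_imageI poly_roots_finite) auto
  then have "\<forall>\<^sub>F x in at r. x \<notin> cmod ` {z. poly p z = 0}"
    using islimpt_finite islimpt_iff_eventually by blast
  moreover have "\<forall>\<^sub>F x in at r. x > 0"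
    using order_tendstoD(1)[OF tendsto_ident_at r] .
  ultimately have "\<forall>\<^sub>F x in at r. cmod (poly p 0) * x ^ size R \<le> B x * (\<Prod>z\<in>#R. cmod z)"
  proof eventually_elim
    case (elim x)
    then show ?case
      using p0 R B mean by (intro geometric_mean_bound_imp_root_bound_off_circle) auto
  qed
  moreover have "((\<lambda>x. cmod (poly p 0) * x ^ size R) \<longlongrightarrow> cmod (poly p 0) * r ^ size R) (at r)"
    by (intro tendsto_intros)
  moreover have "((\<lambda>x. B x * (\<Prod>z\<in>#R. cmod z)) \<longlongrightarrow> B r * (\<Prod>z\<in>#R. cmod z)) (at r)"
    using B(1) by (intro tendsto_intros) (simp add: isCont_def)
  ultimately show ?thesis by (intro tendsto_le[OF trivial_limit_at]) auto
qed

section \<open>Hadamard's inequality\<close>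

lemma prod_le_arith_mean_power:
  fixes x :: "'a \<Rightarrow> real"
  assumes "finite S" "S \<noteq> {}" "\<And>i. i \<in> S \<Longrightarrow> x i \<ge> 0"
  shows "(\<Prod>i\<in>S. x i) \<le> ((\<Sum>i\<in>S. x i) / card S) ^ card S"
proof -
  have card: "card S > 0" using assms by (simp add: card_gt_0_iff)
  have nonneg: "(\<Prod>i\<in>S. x i) \<ge> 0" using assms by (simp add: prod_nonneg)
  have "(\<Prod>i\<in>S. x i) = root (card S) (\<Prod>i\<in>S. x i) ^ card S"
    using card nonneg by simp
  also have "\<dots> \<le> ((\<Sum>i\<in>S. x i) / card S) ^ card S"
  proof (rule power_mono)
    show "root (card S) (\<Prod>i\<in>S. x i) \<le> (\<Sum>i\<in>S. x i) / card S"
    proof (cases "(\<Prod>i\<in>S. x i) = 0")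
      case True
      then show ?thesis unfolding True using assms by (simp add: sum_nonneg)
    next
      case False
      then show ?thesis
        using arith_geom_mean[OF assms] card nonneg
        by (simp add: root_powr_inverse sum_divide_distrib inverse_eq_divide)
    qed
    show "0 \<le> root (card S) (\<Prod>i\<in>S. x i)" using nonneg card by simp
  qed
  finally show ?thesis .
qed

definition hermitian_dot :: "complex ^ 'n \<Rightarrow> complex ^ 'n \<Rightarrow> complex" where
  "hermitian_dot u v = (\<Sum>l\<in>UNIV. u $ l * cnj (v $ l))"

lemma inner_conv_hermitian_dot: "u \<bullet> v = Re (hermitian_dot u v)"
  by (simp add: inner_vec_def inner_complex_def hermitian_dot_def)

lemma hermitian_dot_self: "hermitian_dot u u = of_real ((norm u)\<^sup>2)"
proof -
  have "(norm u)\<^sup>2 = (\<Sum>l\<in>UNIV. (cmod (u $ l))\<^sup>2)"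
    by (simp add: norm_vec_def L2_set_def sum_nonneg)
  then show ?thesis
    by (simp add: hermitian_dot_def complex_norm_square del: of_real_power)
qed

lemma cnj_hermitian_dot: "cnj (hermitian_dot u v) = hermitian_dot v u"
  by (simp add: hermitian_dot_def mult.commute)

lemma hermitian_dot_scale_right: "hermitian_dot u (a *s v) = cnj a * hermitian_dot u v"
  by (simp add: hermitian_dot_def sum_distrib_left mult_ac)

text \<open>
  One Gram--Schmidt step. The complex span \<open>V\<close> of the rows in \<open>S\<close> is also a real subspace, so
  the real orthogonal decomposition applies to it. Since \<open>V\<close> is stable under multiplication by
  \<open>\<i>\<close>, a vector that is orthogonal to \<open>V\<close> for the real inner product is orthogonal
  for the Hermitian one.
\<close>

lemma orthogonalize_row:
  fixes A :: "complex ^ 'n ^ 'n"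
  assumes "k \<notin> S"
  obtains z where "det (\<chi> i. if i = k then z else A $ i) = det A" "norm z \<le> norm (A $ k)"
    "\<And>i. i \<in> S \<Longrightarrow> hermitian_dot z (A $ i) = 0"
proof -
  define V where "V = vec.span {A $ i |i. i \<in> S}"
  have "subspace V"
  proof -
    have "c *\<^sub>R x = complex_of_real c *s x" for c :: real and x :: "complex ^ 'n"
      by (simp add: vec_eq_iff complex_eq_iff)
    then show ?thesis
      unfolding subspace_def V_def by (simp add: vec.span_zero vec.span_add vec.span_scale)
  qed
  then have span: "span V = V" by (simp add: span_eq_iff)
  obtain y z where y: "y \<in> V" and z: "\<And>w. w \<in> V \<Longrightarrow> orthogonal z w" and yz: "A $ k = y + z"
    using orthogonal_subspace_decomp_exists[of V "A $ k"] unfolding span by metis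
  have perp: "hermitian_dot z w = 0" if "w \<in> V" for w
  proof -
    have "\<i> *s w \<in> V" using that unfolding V_def by (rule vec.span_scale)
    with z[OF this] z[OF that] show ?thesis
      by (simp add: orthogonal_def inner_conv_hermitian_dot hermitian_dot_scale_right complex_eq_iff)
  qed
  have "(norm (A $ k))\<^sup>2 = (norm y)\<^sup>2 + (norm z)\<^sup>2"
    unfolding yz using z[OF y] by (intro norm_add_Pythagorean) (simp add: orthogonal_commute)
  then have norm: "norm z \<le> norm (A $ k)"
    using power2_le_imp_le[of "norm z" "norm (A $ k)"] by simp
  have "- y \<in> vec.span {row j A |j. j \<noteq> k}"
  proof -
    have "V \<subseteq> vec.span {row j A |j. j \<noteq> k}"
      unfolding V_def using assms by (intro vec.span_mono) (auto simp: row_def vec_eq_iff)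
    then show ?thesis using y vec.span_neg by blast
  qed
  from det_row_span[OF this]
  have "det (\<chi> i. if i = k then row k A + - y else row i A) = det A" .
  also have "(\<chi> i. if i = k then row k A + - y else row i A) = (\<chi> i. if i = k then z else A $ i)"
    using yz by (auto simp: vec_eq_iff row_def)
  finally have "det (\<chi> i. if i = k then z else A $ i) = det A" .
  moreover have "A $ i \<in> V" if "i \<in> S" for i
    unfolding V_def by (rule vec.span_base) (use that in blast)
  ultimately show ?thesis using that norm perp by blast
qed

text \<open>
  If \<open>C\<close> is the conjugate transpose of \<open>B\<close>, then \<open>B ** C\<close> is the diagonal matrix of the squared
  norms of the rows and its determinant is \<open>\<bar>det B\<bar>\<^sup>2\<close>.
\<close>

lemma cmod_det_orthogonal_rows:
  fixes B :: "complex ^ 'n ^ 'n"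
  assumes "\<And>i j. i \<noteq> j \<Longrightarrow> hermitian_dot (B $ i) (B $ j) = 0"
  shows "cmod (det B) = (\<Prod>i\<in>UNIV. norm (B $ i))"
proof -
  define C :: "complex ^ 'n ^ 'n" where "C = (\<chi> i j. cnj (B $ j $ i))"
  have "det C = det (transpose C)" by simp
  also have "\<dots> = cnj (det B)"
    by (simp add: det_def C_def transpose_def cnj_sum cnj_prod)
  finally have C: "det C = cnj (det B)" .
  have BC: "(B ** C) $ i $ j = hermitian_dot (B $ i) (B $ j)" for i j
    by (simp add: matrix_matrix_mult_def C_def hermitian_dot_def)
  have "of_real ((cmod (det B))\<^sup>2) = det (B ** C)"
    by (simp add: det_mul C complex_norm_square del: of_real_power)
  also have "\<dots> = (\<Prod>i\<in>UNIV. hermitian_dot (B $ i) (B $ i))"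
    using assms by (subst det_diagonal) (auto simp: BC)
  also have "\<dots> = of_real ((\<Prod>i\<in>UNIV. norm (B $ i))\<^sup>2)"
    by (simp add: hermitian_dot_self prod_power_distrib)
  finally have "(cmod (det B))\<^sup>2 = (\<Prod>i\<in>UNIV. norm (B $ i))\<^sup>2"
    using of_real_eq_iff by blast
  then show ?thesis by (simp add: prod_nonneg power2_eq_iff_nonneg)
qed

text \<open>
  Making the rows orthogonal one after the other keeps the determinant and does not increase any
  row norm, and for orthogonal rows equality holds.
\<close>

theorem hadamard_inequality:
  fixes A :: "complex ^ 'n ^ 'n"
  shows "cmod (det A) \<le> (\<Prod>i\<in>UNIV. norm (A $ i))"
proof -
  have "\<exists>B. det B = det A \<and> (\<forall>i. norm (B $ i) \<le> norm (A $ i)) \<and>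
      (\<forall>i\<in>S. \<forall>j\<in>S. i \<noteq> j \<longrightarrow> hermitian_dot (B $ i) (B $ j) = 0)" if "finite S" for S
    using that
  proof induction
    case empty
    show ?case by (intro exI[of _ A]) simp
  next
    case (insert k S)
    from insert.IH obtain B :: "complex ^ 'n ^ 'n" where B: "det B = det A" "\<And>i. norm (B $ i) \<le> norm (A $ i)"
      "\<And>i j. i \<in> S \<Longrightarrow> j \<in> S \<Longrightarrow> i \<noteq> j \<Longrightarrow> hermitian_dot (B $ i) (B $ j) = 0" by blast
    obtain z where z: "det (\<chi> i. if i = k then z else B $ i) = det B" "norm z \<le> norm (B $ k)"
      "\<And>i. i \<in> S \<Longrightarrow> hermitian_dot z (B $ i) = 0"
      using orthogonalize_row[OF insert.hyps(2), of B] by blast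
    have z': "hermitian_dot (B $ i) z = 0" if "i \<in> S" for i
      using z(3)[OF that] by (metis cnj_hermitian_dot complex_cnj_zero)
    have z_le: "norm z \<le> norm (A $ k)" using z(2) B(2)[of k] by linarith
    define B' where "B' = (\<chi> i. if i = k then z else B $ i)"
    have B'k: "B' $ k = z" by (simp add: B'_def)
    have B'S: "B' $ i = B $ i" if "i \<noteq> k" for i
      using that by (simp add: B'_def)
    have "det B' = det A" using z(1) B(1) by (simp add: B'_def)
    moreover have "norm (B' $ i) \<le> norm (A $ i)" for i
      using z_le B(2)[of i] B'k B'S by (cases "i = k") auto
    moreover have "hermitian_dot (B' $ i) (B' $ j) = 0"
      if "i \<in> insert k S" "j \<in> insert k S" "i \<noteq> j" for i j
      using that z(3) z' B(3) insert.hyps(2) B'k B'S by (cases "i = k"; cases "j = k") auto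
    ultimately show ?case by blast
  qed
  from this[of UNIV] obtain B :: "complex ^ 'n ^ 'n" where B: "det B = det A" "\<And>i. norm (B $ i) \<le> norm (A $ i)"
      "\<And>i j. i \<noteq> j \<Longrightarrow> hermitian_dot (B $ i) (B $ j) = 0" by (metis UNIV_I finite)
  have "cmod (det A) = (\<Prod>i\<in>UNIV. norm (B $ i))"
    using cmod_det_orthogonal_rows[of B] B by simp
  also have "\<dots> \<le> (\<Prod>i\<in>UNIV. norm (A $ i))"
    using B(2) by (intro prod_mono) auto
  finally show ?thesis .
qed

lemma normalized_frobenius_power2:
  fixes A :: "complex ^ 'n ^ 'n"
  shows "(normalized_frobenius A)\<^sup>2 = (\<Sum>i\<in>UNIV. \<Sum>j\<in>UNIV. (cmod (A $ i $ j))\<^sup>2) / CARD('n)"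
  by (simp add: normalized_frobenius_def sum_nonneg)

lemma cmod_det_le_normalized_frobenius_power:
  fixes A :: "complex ^ 'n ^ 'n"
  shows "(cmod (det A))\<^sup>2 \<le> ((normalized_frobenius A)\<^sup>2) ^ CARD('n)"
proof -
  have "(cmod (det A))\<^sup>2 \<le> (\<Prod>i\<in>UNIV. norm (A $ i))\<^sup>2"
    by (intro power_mono hadamard_inequality) auto
  also have "\<dots> = (\<Prod>i\<in>UNIV. (norm (A $ i))\<^sup>2)" by (simp add: prod_power_distrib)
  also have "\<dots> \<le> ((\<Sum>i\<in>UNIV. (norm (A $ i))\<^sup>2) / CARD('n)) ^ CARD('n)"
    by (intro prod_le_arith_mean_power) auto
  also have "(\<Sum>i\<in>UNIV. (norm (A $ i))\<^sup>2) = (\<Sum>i\<in>UNIV. \<Sum>j\<in>UNIV. (cmod (A $ i $ j))\<^sup>2)"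
    by (simp add: norm_vec_def L2_set_def sum_nonneg)
  finally show ?thesis by (simp add: normalized_frobenius_power2)
qed

text \<open>
  Multiplying all roots of unity by a primitive one permutes them, and it multiplies the sum by a
  factor that differs from \<open>1\<close> unless \<open>k = l\<close>.
\<close>

section \<open>Parseval's identity on the roots of unity\<close>

lemma sum_roots_unity_character:
  assumes "k < M" "l < M"
  shows "(\<Sum>w::complex | w ^ M = 1. w ^ k * cnj w ^ l) = (if k = l then of_nat M else 0)"
proof -
  have M: "M > 0" using assms by simp
  have unit: "w * cnj w = 1" if "w ^ M = 1" for w :: complex
  proof -
    have "cmod w ^ M = 1" using that by (metis norm_one norm_power)
    then have "cmod w = 1" using M power_eq_imp_eq_base[of "cmod w" M 1] by simp
    then show ?thesis by (simp flip: complex_norm_square)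
  qed
  show ?thesis
  proof (cases "k = l")
    case True
    then have "(\<Sum>w::complex | w ^ M = 1. w ^ k * cnj w ^ l) = (\<Sum>w::complex | w ^ M = 1. 1)"
      using unit by (intro sum.cong) (auto simp flip: power_mult_distrib)
    then show ?thesis using True M by (simp add: card_roots_unity_eq)
  next
    case False
    define \<omega> where "\<omega> = cis (2 * pi / real M)"
    have \<omega>: "\<omega> ^ M = 1" using M by (simp add: \<omega>_def Complex.DeMoivre)
    have \<omega>_nz: "\<omega> \<noteq> 0" by (simp add: \<omega>_def)
    have inj: "inj_on (\<lambda>k. \<omega> ^ k) {..<M}"
      using Complex.bij_betw_roots_unity[OF M] by (simp add: bij_betw_def \<omega>_def Complex.DeMoivre mult_ac)
    have ne: "\<omega> ^ k * cnj \<omega> ^ l \<noteq> 1"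
    proof
      assume "\<omega> ^ k * cnj \<omega> ^ l = 1"
      then have "\<omega> ^ k * (\<omega> * cnj \<omega>) ^ l = \<omega> ^ l" by (simp add: power_mult_distrib mult_ac)
      then have "\<omega> ^ k = \<omega> ^ l" using unit[OF \<omega>] by simp
      with inj False assms show False by (auto dest: inj_onD)
    qed
    have "bij_betw (\<lambda>w. \<omega> * w) {w. w ^ M = 1} {w. w ^ M = 1}"
      by (rule bij_betw_byWitness[where f' = "\<lambda>w. w / \<omega>"])
         (use \<omega> \<omega>_nz in \<open>auto simp: power_mult_distrib power_divide\<close>)
    from sum.reindex_bij_betw[OF this, of "\<lambda>w. w ^ k * cnj w ^ l"]
    have "(\<Sum>w | w ^ M = 1. w ^ k * cnj w ^ l) =
        \<omega> ^ k * cnj \<omega> ^ l * (\<Sum>w | w ^ M = 1. w ^ k * cnj w ^ l)"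
      by (simp add: power_mult_distrib sum_distrib_left mult_ac)
    then show ?thesis using ne False by simp
  qed
qed

lemma parseval_roots_unity:
  fixes c :: "nat \<Rightarrow> complex"
  assumes "d < M"
  shows "(\<Sum>w | w ^ M = 1. (cmod (\<Sum>k\<le>d. c k * (of_real r * w) ^ k))\<^sup>2) =
    M * (\<Sum>k\<le>d. (cmod (c k))\<^sup>2 * r ^ (2 * k))"
proof -
  define a where "a k = c k * of_real r ^ k" for k
  have "of_real (\<Sum>w | w ^ M = 1. (cmod (\<Sum>k\<le>d. c k * (of_real r * w) ^ k))\<^sup>2) =
     (\<Sum>w | w ^ M = 1. \<Sum>k\<le>d. \<Sum>l\<le>d. a k * cnj (a l) * (w ^ k * cnj w ^ l))"
    by (simp del: of_real_power add: complex_norm_square sum_product a_def power_mult_distrib mult_ac)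
  also have "\<dots> = (\<Sum>k\<le>d. \<Sum>l\<le>d. a k * cnj (a l) * (\<Sum>w | w ^ M = 1. w ^ k * cnj w ^ l))"
    by (subst sum.swap, intro sum.cong refl, subst sum.swap) (simp add: sum_distrib_left)
  also have "\<dots> = (\<Sum>k\<le>d. \<Sum>l\<le>d. if k = l then of_nat M * (a k * cnj (a l)) else 0)"
    using assms by (intro sum.cong) (auto simp: sum_roots_unity_character)
  also have "\<dots> = (\<Sum>k\<le>d. of_nat M * of_real ((cmod (a k))\<^sup>2))"
    by (intro sum.cong refl) (auto simp: complex_norm_square simp del: of_real_power)
  also have "\<dots> = of_real (M * (\<Sum>k\<le>d. (cmod (a k))\<^sup>2))" by (simp add: sum_distrib_left)
  finally have "(\<Sum>w | w ^ M = 1. (cmod (\<Sum>k\<le>d. c k * (of_real r * w) ^ k))\<^sup>2) = M * (\<Sum>k\<le>d. (cmod (a k))\<^sup>2)"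
    using of_real_eq_iff by blast
  moreover have "(cmod (a k))\<^sup>2 = (cmod (c k))\<^sup>2 * r ^ (2 * k)" for k
  proof -
    have "(\<bar>r\<bar> ^ k)\<^sup>2 = r ^ (2 * k)" by (metis power_abs power2_abs power_mult mult.commute)
    then show ?thesis by (simp add: a_def norm_mult norm_power power_mult_distrib)
  qed
  ultimately show ?thesis by simp
qed

section \<open>The determinant of a matrix polynomial on a circle\<close>

definition eval_matrix_polynomial ::
    "(nat \<Rightarrow> complex ^ 'n ^ 'n) \<Rightarrow> nat \<Rightarrow> complex \<Rightarrow> complex ^ 'n ^ 'n" where
  "eval_matrix_polynomial A d z = (\<Sum>k\<le>d. \<chi> i j. z ^ k * A k $ i $ j)"

lemma eval_matrix_polynomial_0: "eval_matrix_polynomial A d 0 = A 0"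
  by (induction d) (simp_all add: eval_matrix_polynomial_def vec_eq_iff)

lemma poly_det: "poly (det M) z = det (\<chi> i j. poly (M $ i $ j) z)"
  by (simp add: det_def poly_sum poly_prod sign_def)

lemma poly_det_matrix_polynomial:
  "poly (det (matrix_polynomial A d)) z = det (eval_matrix_polynomial A d z)"
proof -
  have "(\<chi> i j. poly (matrix_polynomial A d $ i $ j) z) = eval_matrix_polynomial A d z"
    by (simp add: vec_eq_iff matrix_polynomial_def eval_matrix_polynomial_def poly_sum poly_monom mult.commute)
  then show ?thesis by (simp add: poly_det)
qed

lemma norm_eval_matrix_polynomial_le:
  assumes "matrix_norm N"
  shows "N (eval_matrix_polynomial A d z) \<le> (\<Sum>k\<le>d. N (A k) * cmod z ^ k)"
proof -
  have add: "N (X + Y) \<le> N X + N Y" and scale: "N (\<chi> i j. c * X $ i $ j) = cmod c * N X" for X Y c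
    using assms by (auto simp: matrix_norm_def)
  show ?thesis
    unfolding eval_matrix_polynomial_def
  proof (induction d)
    case 0
    show ?case by (simp add: vec_lambda_eta)
  next
    case (Suc d)
    then show ?case
      using add[of "\<Sum>k\<le>d. \<chi> i j. z ^ k * A k $ i $ j" "\<chi> i j. z ^ Suc d * A (Suc d) $ i $ j"]
        scale[of "z ^ Suc d" "A (Suc d)"] by (simp add: norm_mult norm_power mult_ac)
  qed
qed

lemma eval_matrix_polynomial_mult_entry:
  fixes A :: "nat \<Rightarrow> complex ^ 'n ^ 'n" and Q Q' :: "complex ^ 'n ^ 'n"
  shows "(Q ** eval_matrix_polynomial A d z ** Q') $ i $ j = (\<Sum>k\<le>d. (Q ** A k ** Q') $ i $ j * z ^ k)"
proof -
  have scale: "(Q ** (\<chi> i j. c * X $ i $ j) ** Q') $ i $ j = (Q ** X ** Q') $ i $ j * c" for c X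
    by (simp add: matrix_matrix_mult_def sum_distrib_left sum_distrib_right mult_ac)
  have add: "(X + Y) ** Q' = X ** Q' + Y ** Q'" for X Y :: "complex ^ 'n ^ 'n"
    by (simp add: vec_eq_iff matrix_matrix_mult_def sum.distrib distrib_right)
  show ?thesis
    unfolding eval_matrix_polynomial_def
    by (induction d) (simp_all add: scale add matrix_add_ldistrib del: power_Suc power_0)
qed

text \<open>
  Parseval's identity in each entry.
\<close>

lemma mean_normalized_frobenius_eval:
  fixes A :: "nat \<Rightarrow> complex ^ 'n ^ 'n" and Q Q' :: "complex ^ 'n ^ 'n"
  assumes "d < M"
  shows "(\<Sum>w | w ^ M = 1. (normalized_frobenius (Q ** eval_matrix_polynomial A d (of_real r * w) ** Q'))\<^sup>2) / M
     = (\<Sum>k\<le>d. (normalized_frobenius (Q ** A k ** Q'))\<^sup>2 * r ^ (2 * k))"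
proof -
  define c where "c k i j = (Q ** A k ** Q') $ i $ j" for k i j
  have "(\<Sum>w | w ^ M = 1. (normalized_frobenius (Q ** eval_matrix_polynomial A d (of_real r * w) ** Q'))\<^sup>2)
     = (\<Sum>w | w ^ M = 1. \<Sum>i\<in>UNIV. \<Sum>j\<in>UNIV. (cmod (\<Sum>k\<le>d. c k i j * (of_real r * w) ^ k))\<^sup>2) / CARD('n)"
    by (simp add: normalized_frobenius_power2 eval_matrix_polynomial_mult_entry c_def sum_divide_distrib)
  also have "(\<Sum>w | w ^ M = 1. \<Sum>i\<in>UNIV. \<Sum>j\<in>UNIV. (cmod (\<Sum>k\<le>d. c k i j * (of_real r * w) ^ k))\<^sup>2)
     = (\<Sum>i\<in>UNIV. \<Sum>j\<in>UNIV. \<Sum>w | w ^ M = 1. (cmod (\<Sum>k\<le>d. c k i j * (of_real r * w) ^ k))\<^sup>2)"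
    by (subst sum.swap, intro sum.cong refl, subst sum.swap) simp
  also have "\<dots> = (\<Sum>i\<in>UNIV. \<Sum>j\<in>UNIV. M * (\<Sum>k\<le>d. (cmod (c k i j))\<^sup>2 * r ^ (2 * k)))"
    by (simp add: parseval_roots_unity[OF assms])
  also have "\<dots> = M * (\<Sum>k\<le>d. (\<Sum>i\<in>UNIV. \<Sum>j\<in>UNIV. (cmod (c k i j))\<^sup>2) * r ^ (2 * k))"
  proof -
    have "(\<Sum>i\<in>UNIV. \<Sum>j\<in>UNIV. \<Sum>k\<le>d. (cmod (c k i j))\<^sup>2 * r ^ (2 * k)) =
       (\<Sum>i\<in>UNIV. \<Sum>k\<le>d. \<Sum>j\<in>UNIV. (cmod (c k i j))\<^sup>2 * r ^ (2 * k))"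
      by (intro sum.cong refl sum.swap)
    also have "\<dots> = (\<Sum>k\<le>d. \<Sum>i\<in>UNIV. \<Sum>j\<in>UNIV. (cmod (c k i j))\<^sup>2 * r ^ (2 * k))"
      by (rule sum.swap)
    finally show ?thesis by (simp add: sum_distrib_right flip: sum_distrib_left)
  qed
  finally have "(\<Sum>w | w ^ M = 1. (normalized_frobenius (Q ** eval_matrix_polynomial A d (of_real r * w) ** Q'))\<^sup>2)
     = M * ((\<Sum>k\<le>d. (\<Sum>i\<in>UNIV. \<Sum>j\<in>UNIV. (cmod (c k i j))\<^sup>2) * r ^ (2 * k)) / CARD('n))"
    by simp
  also have "(\<Sum>k\<le>d. (\<Sum>i\<in>UNIV. \<Sum>j\<in>UNIV. (cmod (c k i j))\<^sup>2) * r ^ (2 * k)) / CARD('n) =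
     (\<Sum>k\<le>d. (normalized_frobenius (Q ** A k ** Q'))\<^sup>2 * r ^ (2 * k))"
    by (simp add: normalized_frobenius_power2 c_def flip: sum_divide_distrib)
  finally show ?thesis using assms by simp
qed

lemma prod_det_roots_unity_le_A1:
  fixes A :: "nat \<Rightarrow> complex ^ 'n ^ 'n"
  assumes N: "matrix_norm N" and A1: "assumption_A1 N" and r: "r > 0" and M: "M > 0"
  shows "(\<Prod>w | w ^ M = 1. cmod (det (eval_matrix_polynomial A d (of_real r * w)))) \<le>
    ((\<Sum>k\<le>d. N (A k) * r ^ k) ^ CARD('n)) ^ M"
proof -
  have nonneg: "N X \<ge> 0" for X using N by (simp add: matrix_norm_def)
  have "(\<Prod>w | w ^ M = 1. cmod (det (eval_matrix_polynomial A d (of_real r * w)))) \<le>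
     (\<Prod>w::complex | w ^ M = 1. (\<Sum>k\<le>d. N (A k) * r ^ k) ^ CARD('n))"
  proof (intro prod_mono conjI)
    fix w :: complex assume "w \<in> {w. w ^ M = 1}"
    then have "cmod w ^ M = 1 ^ M" by (simp flip: norm_power)
    then have "cmod w = 1" using M by (metis norm_ge_zero power_eq_imp_eq_base zero_le_one)
    then have "N (eval_matrix_polynomial A d (of_real r * w)) \<le> (\<Sum>k\<le>d. N (A k) * r ^ k)"
      using norm_eval_matrix_polynomial_le[OF N, of A d "of_real r * w"] r by (simp add: norm_mult)
    then have "N (eval_matrix_polynomial A d (of_real r * w)) ^ CARD('n) \<le> (\<Sum>k\<le>d. N (A k) * r ^ k) ^ CARD('n)"
      by (intro power_mono nonneg)
    then show "cmod (det (eval_matrix_polynomial A d (of_real r * w))) \<le> (\<Sum>k\<le>d. N (A k) * r ^ k) ^ CARD('n)"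
      using A1 order_trans unfolding assumption_A1_def by blast
  qed simp
  then show ?thesis using M by (simp add: card_roots_unity_eq)
qed

text \<open>
  For each \<open>w\<close>, \<open>\<bar>det P(r w)\<bar>\<^sup>2\<close> is at most the \<open>n\<close>-th power of the squared Frobenius norm of \<open>Q P(r w) Q'\<close>, because \<open>Q\<close>
  and \<open>Q'\<close> have determinant \<open>1\<close>. The product over \<open>w\<close> of these squared norms is bounded by the
  \<open>M\<close>-th power of their mean, which has no cross terms.
\<close>

lemma prod_det_roots_unity_le_A2:
  fixes A :: "nat \<Rightarrow> complex ^ 'n ^ 'n"
  assumes A2: "assumption_A2 N" and r: "r > 0" and M: "M > d"
  shows "(\<Prod>w | w ^ M = 1. cmod (det (eval_matrix_polynomial A d (of_real r * w)))) \<le>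
    (sqrt (\<Sum>k\<le>d. (N (A k))\<^sup>2 * r ^ (2 * k)) ^ CARD('n)) ^ M"
proof -
  obtain Q Q' :: "complex ^ 'n ^ 'n" where Q: "det Q = 1" "det Q' = 1"
    and le: "\<And>X. normalized_frobenius (Q ** X ** Q') \<le> N X"
    using A2 unfolding assumption_A2_def by blast
  define S where "S = (\<Sum>k\<le>d. (N (A k))\<^sup>2 * r ^ (2 * k))"
  define P where "P w = eval_matrix_polynomial A d (of_real r * w)" for w
  define g where "g w = (normalized_frobenius (Q ** P w ** Q'))\<^sup>2" for w
  have S: "S \<ge> 0" unfolding S_def using r by (intro sum_nonneg) auto
  have card: "card {w::complex. w ^ M = 1} = M" using M by (simp add: card_roots_unity_eq)
  have fin: "finite {w::complex. w ^ M = 1}" using M by (intro finite_roots_unity) auto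
  have ne: "{w::complex. w ^ M = 1} \<noteq> {}" by (auto intro: exI[of _ 1])
  have "(\<Prod>w | w ^ M = 1. cmod (det (P w)))\<^sup>2 = (\<Prod>w | w ^ M = 1. (cmod (det (Q ** P w ** Q')))\<^sup>2)"
    using Q by (simp add: prod_power_distrib det_mul)
  also have "\<dots> \<le> (\<Prod>w | w ^ M = 1. g w ^ CARD('n))"
    unfolding g_def by (intro prod_mono conjI cmod_det_le_normalized_frobenius_power) simp
  also have "\<dots> = (\<Prod>w | w ^ M = 1. g w) ^ CARD('n)" by (simp add: prod_power_distrib)
  also have "\<dots> \<le> (((\<Sum>w | w ^ M = 1. g w) / M) ^ M) ^ CARD('n)"
    using prod_le_arith_mean_power[OF fin ne, of g] unfolding card
    by (intro power_mono prod_nonneg) (auto simp: g_def)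
  also have "\<dots> \<le> (S ^ M) ^ CARD('n)"
  proof (intro power_mono)
    have "(\<Sum>w | w ^ M = 1. g w) / M = (\<Sum>k\<le>d. (normalized_frobenius (Q ** A k ** Q'))\<^sup>2 * r ^ (2 * k))"
      unfolding g_def P_def by (rule mean_normalized_frobenius_eval[OF M])
    also have "\<dots> \<le> S"
      unfolding S_def using r le
      by (intro sum_mono mult_right_mono power_mono) (auto simp: normalized_frobenius_def sum_nonneg)
    finally show "(\<Sum>w | w ^ M = 1. g w) / M \<le> S" .
  qed (simp_all add: g_def sum_nonneg)
  also have "\<dots> = ((sqrt S ^ CARD('n)) ^ M)\<^sup>2"
  proof -
    have "(S ^ M) ^ CARD('n) = (((sqrt S)\<^sup>2) ^ M) ^ CARD('n)" using S by simp
    then show ?thesis by (simp only: mult_ac flip: power_mult)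
  qed
  finally have "(\<Prod>w | w ^ M = 1. cmod (det (P w))) \<le> (sqrt S ^ CARD('n)) ^ M"
    by (rule power2_le_imp_le) (use S in auto)
  then show ?thesis by (simp add: P_def S_def)
qed

section \<open>Tropical roots\<close>

text \<open>
  After cancelling the common initial segment, the two products have the same number of factors. For
  \<open>J \<le> K\<close> the values of \<open>b\<close> that remain on the left are at most \<open>b K\<close>; for \<open>J > K\<close> those that remain
  on the right are at least \<open>b K\<close>.
\<close>

lemma prod_initial_segment_times_power_le:
  fixes b :: "nat \<Rightarrow> real"
  assumes mono: "mono_on {1..m} b" and pos: "\<And>i. i \<in> {1..m} \<Longrightarrow> b i > 0"
    and K: "K \<in> {1..m}" and J: "J \<le> m"
  shows "(\<Prod>i=1..K. b i) * b K ^ J \<le> b K ^ K * (\<Prod>i=1..J. b i)"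
proof (cases "J \<le> K")
  case True
  have "(\<Prod>i=J+1..K. b i) \<le> (\<Prod>i=J+1..K. b K)"
    using K by (intro prod_mono conjI mono_onD[OF mono] less_imp_le[OF pos]) auto
  then have "(\<Prod>i=1..J. b i) * (\<Prod>i=J+1..K. b i) * b K ^ J \<le> (\<Prod>i=1..J. b i) * b K ^ (K - J) * b K ^ J"
    using K J pos[OF K] by (intro mult_right_mono mult_left_mono prod_nonneg less_imp_le[OF pos]) auto
  also have "\<dots> = b K ^ K * (\<Prod>i=1..J. b i)"
    using True by (simp flip: power_add)
  finally show ?thesis
    using prod.ub_add_nat[of 1 J b "K - J"] True by simp
next
  case False
  have "(\<Prod>i=K+1..J. b K) \<le> (\<Prod>i=K+1..J. b i)"
    using K J by (intro prod_mono conjI mono_onD[OF mono] less_imp_le[OF pos]) auto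
  then have "(\<Prod>i=1..K. b i) * b K ^ (J - K) * b K ^ K \<le> (\<Prod>i=1..K. b i) * (\<Prod>i=K+1..J. b i) * b K ^ K"
    using K J pos[OF K] by (intro mult_right_mono mult_left_mono prod_nonneg less_imp_le[OF pos]) auto
  also have "(\<Prod>i=1..K. b i) * b K ^ (J - K) * b K ^ K = (\<Prod>i=1..K. b i) * b K ^ J"
    using False by (simp flip: power_add)
  finally show ?thesis
    using prod.ub_add_nat[of 1 K b "J - K"] False by (simp add: mult_ac)
qed

lemma nat_ceiling_divide_block:
  assumes "n > 0" "i \<in> {n * j + 1..n * j + n}"
  shows "nat \<lceil>real i / real n\<rceil> = Suc j"
proof -
  have "real (n * j) < real i" "real i \<le> real (n * Suc j)"
    using assms by (simp_all only: of_nat_less_iff of_nat_le_iff) auto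
  then have "\<lceil>real i / real n\<rceil> = int (Suc j)"
    using assms(1) by (intro ceiling_unique) (simp_all add: field_simps)
  then show ?thesis by (simp only: nat_int)
qed

text \<open>
  The indices \<open>n * j + 1, \<dots>, n * j + n\<close> are those whose quotient by \<open>n\<close> rounds up to \<open>j + 1\<close>, so
  each \<open>\<alpha> i\<close> occurs \<open>n\<close> times.
\<close>

lemma prod_ceiling_blocks:
  fixes \<alpha> :: "nat \<Rightarrow> real"
  assumes "n > 0"
  shows "(\<Prod>i=1..n * j. \<alpha> (nat \<lceil>real i / real n\<rceil>)) = (\<Prod>i=1..j. \<alpha> i) ^ n"
proof (induction j)
  case (Suc j)
  have "(\<Prod>i=n * j + 1..n * j + n. \<alpha> (nat \<lceil>real i / real n\<rceil>)) = (\<Prod>i=n * j + 1..n * j + n. \<alpha> (Suc j))"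
    using nat_ceiling_divide_block[OF assms] by (intro prod.cong refl) simp
  then show ?case
    using Suc prod.ub_add_nat[of 1 "n * j" "\<lambda>i. \<alpha> (nat \<lceil>real i / real n\<rceil>)" n]
    by (simp add: power_mult_distrib add.commute)
qed simp

text \<open>
  Evaluation of the tropical polynomial at \<open>0\<close>.
\<close>

lemma tropical_constant_coefficient:
  assumes "tropical_roots N A d \<alpha>" and nonneg: "\<And>X. N X \<ge> 0"
  shows "N (A 0) = N (A d) * (\<Prod>i=1..d. \<alpha> i)"
proof -
  have "tropical_polynomial N A d 0 = N (A 0)"
    unfolding tropical_polynomial_def by (intro Max_eqI) (auto simp: power_0_left nonneg)
  moreover have "(\<Prod>i=1..d. max 0 (\<alpha> i)) = (\<Prod>i=1..d. \<alpha> i)"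
    using assms(1) by (intro prod.cong) (auto simp: tropical_roots_def)
  ultimately show ?thesis using assms(1) by (simp add: tropical_roots_def)
qed

text \<open>
  At \<open>x = \<alpha> j\<close> the monomial of index \<open>j\<close> is at most the tropical polynomial, whose factored form there
  is \<open>N (A d) * \<alpha> j ^ j\<close> times the product of the larger roots. Multiplying by the smaller roots
  completes the product to the one for the constant coefficient.
\<close>

lemma tropical_coefficient_le:
  assumes "tropical_roots N A d \<alpha>" "j \<le> d" and nonneg: "\<And>X. N X \<ge> 0"
  shows "N (A j) * (\<Prod>i=1..j. \<alpha> i) \<le> N (A 0)"
proof -
  have \<alpha>: "\<And>i. i \<in> {1..d} \<Longrightarrow> \<alpha> i \<ge> 0" "mono_on {1..d} \<alpha>"
    and eq: "\<And>x. x \<ge> 0 \<Longrightarrow> tropical_polynomial N A d x = N (A d) * (\<Prod>i=1..d. max x (\<alpha> i))"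
    using assms(1) by (auto simp: tropical_roots_def)
  have ge: "N (A l) * x ^ l \<le> N (A d) * (\<Prod>i=1..d. max x (\<alpha> i))" if "l \<le> d" "x \<ge> 0" for l x
    unfolding eq[OF that(2), symmetric] tropical_polynomial_def using that by (intro Max_ge) auto
  note A0 = tropical_constant_coefficient[OF assms(1) nonneg]
  show ?thesis
  proof (cases "j = 0 \<or> \<alpha> j = 0")
    case True
    then show ?thesis
    proof (cases "j = 0")
      case False
      then have "j \<in> {1..j}" by simp
      with True False have "(\<Prod>i=1..j. \<alpha> i) = 0" by (intro prod_zero) blast+
      then show ?thesis using nonneg[of "A 0"] by (metis mult_zero_right)
    qed simp
  next
    case False
    then have j: "j \<in> {1..d}" using assms(2) by auto
    then have pos: "\<alpha> j > 0" using \<alpha>(1)[of j] False by simp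
    have split: "(\<Prod>i=1..d. f i) = (\<Prod>i=1..j. f i) * (\<Prod>i=j+1..d. f i)" for f :: "nat \<Rightarrow> real"
      using prod.ub_add_nat[of 1 j f "d - j"] assms(2) by simp
    have "(\<Prod>i=1..j. max (\<alpha> j) (\<alpha> i)) = (\<Prod>i=1..j. \<alpha> j)"
      using j by (intro prod.cong refl max_absorb1 mono_onD[OF \<alpha>(2)]) auto
    moreover have "(\<Prod>i=j+1..d. max (\<alpha> j) (\<alpha> i)) = (\<Prod>i=j+1..d. \<alpha> i)"
      using j by (intro prod.cong refl max_absorb2 mono_onD[OF \<alpha>(2)]) auto
    ultimately have "N (A j) * \<alpha> j ^ j \<le> N (A d) * (\<alpha> j ^ j * (\<Prod>i=j+1..d. \<alpha> i))"
      using ge[of j "\<alpha> j"] assms(2) pos split[of "\<lambda>i. max (\<alpha> j) (\<alpha> i)"] by simp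
    then have "N (A j) \<le> N (A d) * (\<Prod>i=j+1..d. \<alpha> i)"
      using pos by (simp add: field_simps)
    then have "N (A j) * (\<Prod>i=1..j. \<alpha> i) \<le> N (A d) * (\<Prod>i=j+1..d. \<alpha> i) * (\<Prod>i=1..j. \<alpha> i)"
      using j \<alpha>(1) by (intro mult_right_mono prod_nonneg) auto
    then show ?thesis unfolding A0 split by (simp add: mult_ac)
  qed
qed

lemma tropical_roots_pos:
  assumes "tropical_roots N A d \<alpha>" "i \<in> {1..d}" and nonneg: "\<And>X. N X \<ge> 0" and "N (A 0) > 0"
  shows "\<alpha> i > 0"
proof -
  have "(\<Prod>i=1..d. \<alpha> i) \<noteq> 0"
    using tropical_constant_coefficient[OF assms(1) nonneg] assms(4)
    by (metis less_irrefl mult_zero_right)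
  then have "\<alpha> i \<noteq> 0" using assms(2) by (metis finite_atLeastAtMost prod_zero)
  then show ?thesis using assms(1,2) by (auto simp: tropical_roots_def less_le)
qed

lemma L_A2_eq_sqrt_L: "L_A2 k = sqrt (L k)"
  by (simp add: L_def L_A2_def real_sqrt_divide)

text \<open>
  This rewrites the constant through \<open>\<tau> = K / (K + n)\<close>, which is \<open>k / (k + 1)\<close> for \<open>k = K / n\<close>. The power
  \<open>n\<close> turns the real exponent \<open>k\<close> into the natural exponent \<open>K\<close>.
\<close>

lemma L_power:
  assumes "K > 0" "n > 0"
  shows "L (real K / real n) ^ n = (real K / (real K + real n)) ^ K * (1 - real K / (real K + real n)) ^ n"
proof -
  define \<tau> where "\<tau> = real K / (real K + real n)"
  have \<tau>: "\<tau> > 0" using assms by (simp add: \<tau>_def)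
  have 1: "(real K / real n + 1) / (real K / real n) = 1 / \<tau>" "1 / (real K / real n + 1) = 1 - \<tau>"
    using assms by (simp_all add: \<tau>_def field_simps)
  have "\<E> (real K / real n) ^ n = (1 / \<tau>) ^ K"
    using \<tau> assms unfolding \<E>_def 1 by (simp add: powr_power powr_realpow)
  moreover have "L (real K / real n) = (1 / \<E> (real K / real n)) * (1 - \<tau>)"
    by (simp add: L_def flip: 1)
  ultimately show ?thesis
    using \<tau> by (simp add: power_mult_distrib power_divide flip: \<tau>_def)
qed

lemma sum_le_geometric:
  fixes \<tau> :: real
  assumes "0 < \<tau>" "\<tau> < 1" "\<And>j. j \<le> d \<Longrightarrow> c j \<le> C" "C \<ge> 0"
  shows "(\<Sum>j\<le>d. c j * \<tau> ^ j) \<le> C / (1 - \<tau>)"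
proof -
  have "(\<Sum>j\<le>d. c j * \<tau> ^ j) \<le> (\<Sum>j\<le>d. C * \<tau> ^ j)"
    using assms by (intro sum_mono mult_right_mono) auto
  also have "\<dots> = C * ((1 - \<tau> ^ Suc d) / (1 - \<tau>))"
    using assms by (simp add: sum_gp0 flip: sum_distrib_left)
  also have "\<dots> \<le> C * (1 / (1 - \<tau>))"
    using assms by (intro mult_left_mono divide_right_mono) auto
  finally show ?thesis by simp
qed

section \<open>Products of eigenvalues\<close>

text \<open>
  The infinite eigenvalues do not contribute to the multiplicity of a finite one.
\<close>

lemma image_Some_subset_eigenvalues:
  assumes "image_mset Some R \<subseteq># eigenvalues A d"
  shows "R \<subseteq># proots (det (matrix_polynomial A d))"
proof (rule mset_subset_eqI)
  fix z
  have some: "count (image_mset Some S) (Some z) = count S z" for S :: "complex multiset"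
    by (induction S) auto
  show "count R z \<le> count (proots (det (matrix_polynomial A d))) z"
    using mset_subset_eq_count[OF assms, of "Some z"]
    by (simp add: eigenvalues_def Let_def some del: count_proots)
qed

lemma eigenvalue_modulus_pos:
  assumes "x \<in># eigenvalues A d" "det (A 0) \<noteq> 0"
  shows "modulus x > 0"
proof (cases x)
  case (Some z)
  define p where "p = det (matrix_polynomial A d)"
  then have p0: "poly p 0 \<noteq> 0"
    using assms(2) by (simp add: p_def poly_det_matrix_polynomial eval_matrix_polynomial_0)
  have "z \<in># proots p"
    using assms(1) Some by (auto simp: eigenvalues_def Let_def p_def split: if_splits)
  moreover have "p \<noteq> 0" using p0 by auto
  ultimately have "poly p z = 0" by simp
  then show ?thesis using p0 Some by auto
qed simp

lemma prod_modulus_pos: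
  assumes "\<And>i. i \<in> S \<Longrightarrow> modulus (\<zeta> i) > 0"
  shows "(\<Prod>i\<in>S. modulus (\<zeta> i)) > 0"
  using assms by (induction S rule: infinite_finite_induct) (auto simp: ereal_zero_less_0_iff)

lemma prod_modulus_eq_infinity:
  assumes "finite S" "\<And>i. i \<in> S \<Longrightarrow> modulus (\<zeta> i) > 0" "i \<in> S" "\<zeta> i = None"
  shows "(\<Prod>i\<in>S. modulus (\<zeta> i)) = \<infinity>"
proof -
  have "(\<Prod>i\<in>S - {i}. modulus (\<zeta> i)) > 0" using assms by (intro prod_modulus_pos) auto
  then show ?thesis using assms by (simp add: prod.remove[of S i])
qed

text \<open>
  A bound on all products of \<open>K\<close> roots of the determinant transfers to the first \<open>K\<close> eigenvalues. If one
  of these is infinite, the product of the moduli is infinite, since the other moduli are not \<open>0\<close>.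
\<close>

lemma eigenvalue_product_ge:
  fixes A :: "nat \<Rightarrow> complex ^ 'n ^ 'n"
  assumes ev: "sorted_eigenvalues A d \<zeta>" and det0: "det (A 0) \<noteq> 0"
    and K: "K \<le> CARD('n) * d" and Q: "Q > 0"
    and fin: "\<And>R. R \<subseteq># proots (det (matrix_polynomial A d)) \<Longrightarrow> size R = K \<Longrightarrow> Q * C \<le> (\<Prod>z\<in>#R. cmod z)"
  shows "(\<Prod>i=1..K. modulus (\<zeta> i)) / ereal Q \<ge> ereal C"
proof -
  have sub: "image_mset \<zeta> (mset_set {1..K}) \<subseteq># eigenvalues A d"
  proof -
    have "mset_set {1..K} \<subseteq># mset_set {1..CARD('n) * d}"
      using K by (intro subset_imp_msubset_mset_set) auto
    then show ?thesis using ev by (metis image_mset_subseteq_mono sorted_eigenvalues_def)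
  qed
  have pos: "modulus (\<zeta> i) > 0" if "i \<in> {1..K}" for i
    using that set_mset_mono[OF sub] by (intro eigenvalue_modulus_pos[of "\<zeta> i" A d] det0) auto
  show ?thesis
  proof (cases "\<exists>i\<in>{1..K}. \<zeta> i = None")
    case True
    then have "(\<Prod>i=1..K. modulus (\<zeta> i)) = \<infinity>"
      using pos prod_modulus_eq_infinity[of "{1..K}" \<zeta>] by blast
    then show ?thesis using Q by simp
  next
    case False
    define R where "R = image_mset (\<lambda>i. the (\<zeta> i)) (mset_set {1..K})"
    have "image_mset Some R = image_mset \<zeta> (mset_set {1..K})"
      unfolding R_def image_mset.compositionality using False by (intro image_mset_cong) auto
    then have "R \<subseteq># proots (det (matrix_polynomial A d))"
      using sub by (intro image_Some_subset_eigenvalues) simp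
    then have "Q * C \<le> (\<Prod>z\<in>#R. cmod z)" by (rule fin) (simp add: R_def)
    also have "(\<Prod>z\<in>#R. cmod z) = (\<Prod>i=1..K. cmod (the (\<zeta> i)))"
      by (simp add: R_def prod_unfold_prod_mset image_mset.compositionality comp_def)
    finally have "C \<le> (\<Prod>i=1..K. cmod (the (\<zeta> i))) / Q" using Q by (simp add: field_simps)
    moreover have "(\<Prod>i=1..K. modulus (\<zeta> i)) = ereal (\<Prod>i=1..K. cmod (the (\<zeta> i)))"
    proof -
      have "(\<Prod>i=1..K. modulus (\<zeta> i)) = (\<Prod>i=1..K. ereal (cmod (the (\<zeta> i))))"
      proof (intro prod.cong refl)
        fix i assume "i \<in> {1..K}"
        then have "\<zeta> i \<noteq> None" using False by metis
        then show "modulus (\<zeta> i) = ereal (cmod (the (\<zeta> i)))" by (cases "\<zeta> i") auto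
      qed
      then show ?thesis by (simp only: prod_ereal)
    qed
    ultimately show ?thesis using Q by (simp only: ereal_divide) auto
  qed
qed

text \<open>
  The final arithmetic: \<open>B\<close> bounds the geometric mean of the determinant over the circle of
  radius \<open>\<beta> * t\<close>, \<open>C\<close> is its modulus at the origin, \<open>Z\<close> is the modulus of a product of \<open>K\<close> roots,
  \<open>Q\<close> is the product of \<open>K\<close> tropical roots, and \<open>1 / u\<close> comes from the sum of a geometric series.
\<close>

lemma root_bound_cancel:
  fixes a0 \<beta> t u B C G Q Z :: real and n K :: nat
  assumes "a0 > 0" "\<beta> > 0" "Q > 0" "u > 0"
    and "C * (\<beta> * t) ^ K \<le> B * Z" "B \<le> (a0 * G / u) ^ n" "G ^ n = \<beta> ^ K / Q" "Z \<ge> 0"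
  shows "Q * (C / a0 ^ n * (t ^ K * u ^ n)) \<le> Z"
proof -
  have "C * (\<beta> * t) ^ K \<le> (a0 * G / u) ^ n * Z"
    using assms(5) mult_right_mono[OF assms(6,8)] by linarith
  also have "\<dots> = a0 ^ n * (\<beta> ^ K / Q) / u ^ n * Z"
    by (simp add: power_mult_distrib power_divide assms(7))
  finally show ?thesis
    using assms by (simp add: power_mult_distrib field_simps)
qed

theorem theorem4p4:
  fixes A :: "nat \<Rightarrow> complex ^ 'n ^ 'n"
    and d :: nat
    and N :: "complex ^ 'n ^ 'n \<Rightarrow> real"
    and \<zeta> :: "nat \<Rightarrow> complex option"
    and \<alpha> \<alpha>bar :: "nat \<Rightarrow> real"
    and c :: real
  assumes "d \<ge> 1"
    and "A d \<noteq> 0"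
    and "sorted_eigenvalues A d \<zeta>"
    and "matrix_norm N"
    and "assumption_A1 N"
    and "det (A 0) \<noteq> 0"
    and "c = cmod (det (A 0)) / N (A 0) ^ CARD('n)"
    and "tropical_roots N A d \<alpha>"
    and "\<And>K. K \<in> {1..CARD('n) * d} \<Longrightarrow> \<alpha>bar K = \<alpha> (nat \<lceil>real K / real CARD('n)\<rceil>)"
  shows "(\<forall>K\<in>{1..CARD('n) * d}.
            (\<Prod>i=1..K. modulus (\<zeta> i)) / ereal (\<Prod>i=1..K. \<alpha>bar i)
              \<ge> ereal (c * L (real K / real CARD('n)) ^ CARD('n))) \<and>
         (assumption_A2 N \<longrightarrow>
          (\<forall>K\<in>{1..CARD('n) * d}.
            (\<Prod>i=1..K. modulus (\<zeta> i)) / ereal (\<Prod>i=1..K. \<alpha>bar i)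
              \<ge> ereal (c * L_A2 (real K / real CARD('n)) ^ CARD('n))))"
proof -
  define n where "n = CARD('n)"
  have n: "n > 0" by (simp add: n_def)
  define p where "p = det (matrix_polynomial A d)"
  have nonneg: "N X \<ge> 0" for X using assms(4) by (simp add: matrix_norm_def)
  have "cmod (det (A 0)) \<le> N (A 0) ^ n"
    using assms(5) by (simp add: assumption_A1_def n_def)
  then have "N (A 0) \<noteq> 0"
    using assms(6) n by (auto simp: zero_power)
  then have a0: "N (A 0) > 0"
    using nonneg[of "A 0"] by linarith
  have p0: "cmod (poly p 0) = cmod (det (A 0))" "poly p 0 \<noteq> 0"
    using assms(6) by (simp_all add: p_def poly_det_matrix_polynomial eval_matrix_polynomial_0)
  have bar: "\<alpha>bar i = \<alpha> (nat \<lceil>real i / real n\<rceil>)" if "i \<in> {1..n * d}" for i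
    using assms(9)[of i] that by (simp add: n_def)
  have idx: "nat \<lceil>real i / real n\<rceil> \<in> {1..d}" if "i \<in> {1..n * d}" for i
  proof -
    have "\<lceil>real i / real n\<rceil> \<le> int d"
      using that n by (simp add: ceiling_le_iff field_simps flip: of_nat_mult)
    moreover have "\<lceil>real i / real n\<rceil> > 0" using that n by simp
    moreover have "nat x \<in> {1..d}" if "x \<le> int d" "x > 0" for x :: int
      using that by auto
    ultimately show ?thesis by blast
  qed
  have bar_pos: "\<alpha>bar i > 0" if "i \<in> {1..n * d}" for i
    unfolding bar[OF that] using tropical_roots_pos[OF assms(8) idx[OF that] nonneg a0] .
  have bar_mono: "mono_on {1..n * d} \<alpha>bar"
  proof (rule mono_onI)
    fix i j assume ij: "i \<in> {1..n * d}" "j \<in> {1..n * d}" "i \<le> j"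
    then have "nat \<lceil>real i / real n\<rceil> \<le> nat \<lceil>real j / real n\<rceil>"
      by (intro nat_mono ceiling_mono divide_right_mono) auto
    then show "\<alpha>bar i \<le> \<alpha>bar j"
      using assms(8) idx ij by (auto simp: bar tropical_roots_def intro: mono_onD)
  qed
  \<comment> \<open>The bound is uniform in \<open>j\<close>. It is proved for \<open>n\<close>-th powers, where \<open>(\<alpha> 1 \<cdots> \<alpha> j) ^ n\<close> is a
      product of \<open>n * j\<close> values of \<open>\<alpha>bar\<close>.\<close>
  have coeff: "\<exists>G\<ge>0. G ^ n = \<alpha>bar K ^ K / (\<Prod>i=1..K. \<alpha>bar i) \<and> (\<forall>j\<le>d. N (A j) * \<alpha>bar K ^ j \<le> N (A 0) * G)"
    if K: "K \<in> {1..n * d}" for K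
  proof -
    define Q where "Q = (\<Prod>i=1..K. \<alpha>bar i)"
    define G where "G = root n (\<alpha>bar K ^ K / Q)"
    have Q: "Q > 0" unfolding Q_def using K by (intro prod_pos bar_pos) auto
    have \<beta>: "\<alpha>bar K > 0" by (rule bar_pos[OF K])
    have G: "G \<ge> 0" "G ^ n = \<alpha>bar K ^ K / Q"
      using Q \<beta> n by (simp_all add: G_def)
    have "N (A j) * \<alpha>bar K ^ j \<le> N (A 0) * G" if j: "j \<le> d" for j
    proof -
      have nj: "n * j \<le> n * d" using j by simp
      have "(\<Prod>i=1..n * j. \<alpha>bar i) = (\<Prod>i=1..n * j. \<alpha> (nat \<lceil>real i / real n\<rceil>))"
        by (intro prod.cong refl bar) (auto intro: le_trans[OF _ nj])
      also have "\<dots> = (\<Prod>i=1..j. \<alpha> i) ^ n" by (rule prod_ceiling_blocks[OF n])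
      finally have blocks: "(\<Prod>i=1..n * j. \<alpha>bar i) = (\<Prod>i=1..j. \<alpha> i) ^ n" .
      have "Q * \<alpha>bar K ^ (n * j) \<le> \<alpha>bar K ^ K * (\<Prod>i=1..j. \<alpha> i) ^ n"
        using prod_initial_segment_times_power_le[OF bar_mono bar_pos K nj]
        by (simp only: Q_def blocks)
      then have "N (A j) ^ n * (Q * \<alpha>bar K ^ (n * j)) \<le> N (A j) ^ n * (\<alpha>bar K ^ K * (\<Prod>i=1..j. \<alpha> i) ^ n)"
        using nonneg by (intro mult_left_mono) auto
      also have "\<dots> = \<alpha>bar K ^ K * (N (A j) * (\<Prod>i=1..j. \<alpha> i)) ^ n"
        by (simp add: power_mult_distrib)
      also have "\<dots> \<le> \<alpha>bar K ^ K * N (A 0) ^ n"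
        using \<beta> j assms(8) nonneg tropical_coefficient_le[OF assms(8) j nonneg]
        by (intro mult_left_mono power_mono mult_nonneg_nonneg prod_nonneg) (auto simp: tropical_roots_def)
      finally have "(N (A j) * \<alpha>bar K ^ j) ^ n \<le> (N (A 0) * G) ^ n"
        using Q by (simp add: G(2) power_mult_distrib field_simps flip: power_mult)
      then show ?thesis
        using n G(1) a0 \<beta> nonneg by (simp add: power_mono_iff)
    qed
    with G show ?thesis unfolding Q_def by blast
  qed
  \<comment> \<open>Here \<open>B r\<close> bounds the geometric mean over the circle of radius \<open>r\<close>.\<close>
  have bound: "ereal (c * (t ^ K * u ^ n)) \<le> (\<Prod>i=1..K. modulus (\<zeta> i)) / ereal (\<Prod>i=1..K. \<alpha>bar i)"
    if K: "K \<in> {1..n * d}" and "t > 0" "u > 0"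
      and cont: "isCont B (\<alpha>bar K * t)" and B: "\<And>r. r > 0 \<Longrightarrow> B r \<ge> 0"
      and mean: "\<And>r M. r > 0 \<Longrightarrow> M > d \<Longrightarrow>
        (\<Prod>w | w ^ M = 1. cmod (poly p (of_real r * w))) \<le> B r ^ M"
      and est: "\<And>G. G \<ge> 0 \<Longrightarrow> (\<And>j. j \<le> d \<Longrightarrow> N (A j) * \<alpha>bar K ^ j \<le> N (A 0) * G) \<Longrightarrow>
        B (\<alpha>bar K * t) \<le> (N (A 0) * G / u) ^ n"
    for K t u B
  proof (rule eigenvalue_product_ge[OF assms(3,6)])
    show Q: "(\<Prod>i=1..K. \<alpha>bar i) > 0" using K by (intro prod_pos bar_pos) auto
    show "K \<le> CARD('n) * d" using K by (simp add: n_def)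
    fix R assume "R \<subseteq># proots (det (matrix_polynomial A d))" "size R = K"
    then have "cmod (poly p 0) * (\<alpha>bar K * t) ^ K \<le> B (\<alpha>bar K * t) * (\<Prod>z\<in>#R. cmod z)"
      using geometric_mean_bound_imp_root_bound[OF p0(2) _ _ cont B mean, of R d] bar_pos[OF K] \<open>t > 0\<close>
      by (simp add: p_def)
    moreover obtain G where "G \<ge> 0" "G ^ n = \<alpha>bar K ^ K / (\<Prod>i=1..K. \<alpha>bar i)"
      "\<And>j. j \<le> d \<Longrightarrow> N (A j) * \<alpha>bar K ^ j \<le> N (A 0) * G" using coeff[OF K] by blast
    moreover have "(\<Prod>z\<in>#R. cmod z) \<ge> 0" by (induction R) auto
    ultimately show "(\<Prod>i=1..K. \<alpha>bar i) * (c * (t ^ K * u ^ n)) \<le> (\<Prod>z\<in>#R. cmod z)"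
      unfolding assms(7) p0(1) n_def[symmetric]
      using a0 bar_pos[OF K] Q \<open>u > 0\<close> est by (intro root_bound_cancel) auto
  qed
  \<comment> \<open>the maximiser of \<open>\<tau> ^ K * (1 - \<tau>) ^ n\<close> on the unit interval\<close>
  define \<tau> where "\<tau> K = real K / (real K + real n)" for K
  have \<tau>: "0 < \<tau> K" "\<tau> K < 1" if "K \<in> {1..n * d}" for K
    using that n by (auto simp: \<tau>_def field_simps)
  show ?thesis
    unfolding n_def[symmetric]
  proof (intro conjI ballI impI)
    fix K assume K: "K \<in> {1..n * d}"
    define B where "B r = (\<Sum>k\<le>d. N (A k) * r ^ k) ^ n" for r
    have "ereal (c * (\<tau> K ^ K * (1 - \<tau> K) ^ n)) \<le> (\<Prod>i=1..K. modulus (\<zeta> i)) / ereal (\<Prod>i=1..K. \<alpha>bar i)"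
    proof (rule bound[OF K, where B = B])
      show "isCont B (\<alpha>bar K * \<tau> K)" unfolding B_def by (intro continuous_intros)
      show "B r \<ge> 0" if "r > 0" for r
        unfolding B_def using that nonneg by (intro zero_le_power sum_nonneg) auto
      show "(\<Prod>w | w ^ M = 1. cmod (poly p (of_real r * w))) \<le> B r ^ M" if "r > 0" "M > d" for r M
        using prod_det_roots_unity_le_A1[OF assms(4,5) that(1), of M A d] that(2)
        by (simp add: p_def poly_det_matrix_polynomial B_def n_def)
      fix G assume G: "G \<ge> 0" "\<And>j. j \<le> d \<Longrightarrow> N (A j) * \<alpha>bar K ^ j \<le> N (A 0) * G"
      have "(\<Sum>k\<le>d. N (A k) * \<alpha>bar K ^ k * \<tau> K ^ k) \<le> N (A 0) * G / (1 - \<tau> K)"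
        using \<tau>[OF K] G a0 by (intro sum_le_geometric) auto
      then show "B (\<alpha>bar K * \<tau> K) \<le> (N (A 0) * G / (1 - \<tau> K)) ^ n"
        unfolding B_def using nonneg bar_pos[OF K] \<tau>[OF K]
        by (intro power_mono sum_nonneg) (auto simp: power_mult_distrib mult_ac)
    qed (use \<tau>[OF K] in auto)
    then show "ereal (c * L (real K / real n) ^ n) \<le> (\<Prod>i=1..K. modulus (\<zeta> i)) / ereal (\<Prod>i=1..K. \<alpha>bar i)"
      using K n by (simp add: L_power \<tau>_def)
  next
    fix K assume A2: "assumption_A2 N" and K: "K \<in> {1..n * d}"
    \<comment> \<open>With this \<open>t\<close>, the sum of the squared terms is dominated by a geometric series of ratio \<open>\<tau> K\<close>.\<close>
    define t where "t = sqrt (\<tau> K)"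
    define u where "u = sqrt (1 - \<tau> K)"
    define B where "B r = sqrt (\<Sum>k\<le>d. (N (A k))\<^sup>2 * r ^ (2 * k)) ^ n" for r
    have tu: "t > 0" "u > 0" "t\<^sup>2 = \<tau> K" "u\<^sup>2 = 1 - \<tau> K" using \<tau>[OF K] by (auto simp: t_def u_def)
    have "ereal (c * (t ^ K * u ^ n)) \<le> (\<Prod>i=1..K. modulus (\<zeta> i)) / ereal (\<Prod>i=1..K. \<alpha>bar i)"
    proof (rule bound[OF K tu(1,2), where B = B])
      show "isCont B (\<alpha>bar K * t)" unfolding B_def by (intro continuous_intros)
      show "B r \<ge> 0" if "r > 0" for r
        unfolding B_def by (intro zero_le_power real_sqrt_ge_zero sum_nonneg) auto
      show "(\<Prod>w | w ^ M = 1. cmod (poly p (of_real r * w))) \<le> B r ^ M" if "r > 0" "M > d" for r M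
        using prod_det_roots_unity_le_A2[OF A2 that]
        by (simp add: p_def poly_det_matrix_polynomial B_def n_def)
      fix G assume G: "G \<ge> 0" "\<And>j. j \<le> d \<Longrightarrow> N (A j) * \<alpha>bar K ^ j \<le> N (A 0) * G"
      have "(\<Sum>k\<le>d. (N (A k) * \<alpha>bar K ^ k)\<^sup>2 * \<tau> K ^ k) \<le> (N (A 0) * G)\<^sup>2 / (1 - \<tau> K)"
        using \<tau>[OF K] G nonneg bar_pos[OF K] by (intro sum_le_geometric power_mono) auto
      also have "(\<Sum>k\<le>d. (N (A k) * \<alpha>bar K ^ k)\<^sup>2 * \<tau> K ^ k) = (\<Sum>k\<le>d. (N (A k))\<^sup>2 * (\<alpha>bar K * t) ^ (2 * k))"
        unfolding tu(3)[symmetric]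
        by (intro sum.cong refl) (simp add: power_mult_distrib mult_ac flip: power_mult)
      also have "(N (A 0) * G)\<^sup>2 / (1 - \<tau> K) = (N (A 0) * G / u)\<^sup>2"
        by (simp add: power_divide tu(4))
      finally have "sqrt (\<Sum>k\<le>d. (N (A k))\<^sup>2 * (\<alpha>bar K * t) ^ (2 * k)) \<le> N (A 0) * G / u"
        using a0 G tu(2) by (intro real_le_lsqrt) auto
      then show "B (\<alpha>bar K * t) \<le> (N (A 0) * G / u) ^ n"
        unfolding B_def by (intro power_mono real_sqrt_ge_zero sum_nonneg) auto
    qed
    also have "t ^ K * u ^ n = L_A2 (real K / real n) ^ n"
    proof -
      have "L_A2 (real K / real n) ^ n = sqrt (L (real K / real n) ^ n)"
        by (simp add: L_A2_eq_sqrt_L real_sqrt_power)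
      also have "L (real K / real n) ^ n = \<tau> K ^ K * (1 - \<tau> K) ^ n"
        using K n by (simp add: L_power \<tau>_def)
      finally show ?thesis
        by (simp add: real_sqrt_mult real_sqrt_power t_def u_def)
    qed
    finally show "ereal (c * L_A2 (real K / real n) ^ n) \<le> (\<Prod>i=1..K. modulus (\<zeta> i)) / ereal (\<Prod>i=1..K. \<alpha>bar i)" .
  qed
qed

end
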